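(* Let $n>2$, let $(G,f)$ be an $n$-ary group, let $a\in G$, and let $(G^{\ast}_a,\cdot)$ be the covering group for $(G,f)$. A representation $\Gamma$ of $G^{\ast}_a$ is (by restriction to $G\subseteq G^{\ast}_a$) a representation of $G$ if and only if $\ker \Gamma \cap G\neq \varnothing$. If $\Gamma$ is an irreducible representation of $G^{\ast}_a$, then it is also irreducible as a representation of $G$.
   Context: An $n$-ary group ($n>2$) is a non-empty set $G$ with an operation $f:G^n\to G$ that is associative, i.e. $f(x_1,\ldots,x_{i-1},f(x_i,\ldots,x_{n+i-1}),x_{n+i},\ldots,x_{2n-1})$ does not depend on $i\in\{1,\ldots,n\}$, and such that for every $i$ the equation $f(x_1,\ldots,x_{i-1},z,x_{i+1},\ldots,x_n)=x_0$ has a unique solution $z\in G$ for all given elements. The symbol $\stackrel{(t)}{x}$ denotes $x$ repeated $t$ times (empty if $t=0$). The skew element $\overline{x}$ of $x$ is the unique $z$ with $f(\stackrel{(n-1)}{x},z)=x$. Covering group: for $a\in G$, $G_a^{\ast}=G\times\mathbb{Z}_{n-1}$ (second coordinates taken in $\{0,\ldots,n-2\}$) with multiplication $$\langle x,r\rangle\cdot\langle y,s\rangle = \langle f_{\ast}(x,\stackrel{(r)}{a},y,\stackrel{(s)}{a},\overline{a},\stackrel{(n-2-r\diamond s)}{a}),\,r\diamond s\rangle ,$$ where $r\diamond s=(r+s+1)\ ({\rm mod}\ (n-1))$ and $f_\ast$ means that $f$ is applied once or twice, according to whether the sequence has $n$ or $2n-1$ entries. This is a group with identity $\langle\overline{a},n-2\rangle$.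 The set $G$ is identified with the subset $\{\langle x,0\rangle:x\in G\}$ of $G_a^\ast$; under this identification $f(x_1,\ldots,x_n)=x_1\cdot x_2\cdot\ldots\cdot x_n$. All vector spaces are finite dimensional over $\mathbb{C}$. A representation of the $n$-ary group $(G,f)$ is a map $\Lambda:G\to GL(V)$ with $\Lambda(f(x_1,\ldots,x_n))=\Lambda(x_1)\cdots\Lambda(x_n)$ for all $x_i\in G$ such that $\ker\Lambda=\{x\in G:\Lambda(x)=\mathrm{id}\}$ is non-empty; it is irreducible if $V\neq 0$ and the only subspaces of $V$ invariant under all $\Lambda(x)$, $x\in G$, are $0$ and $V$. Representations of $G_a^\ast$ are ordinary group representations. *)

theory Defs
  imports Complex_Main "HOL-Algebra.Coset"
begin

text \<open>The \<open>n\<close>-ary operation is a function on lists, of which only the values on lists of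
  length \<open>n\<close> over \<open>G\<close> matter.  Positions are counted from \<open>0\<close>.\<close>

locale nary_group =
  fixes n :: nat and G :: "'a set" and f :: "'a list \<Rightarrow> 'a"
  assumes arity: "n > 2"
    and nonempty: "G \<noteq> {}"
    and closed: "\<lbrakk>length xs = n; set xs \<subseteq> G\<rbrakk> \<Longrightarrow> f xs \<in> G"
    and assoc: "\<lbrakk>length xs = 2 * n - 1; set xs \<subseteq> G; i < n; j < n\<rbrakk> \<Longrightarrow>
          f (take i xs @ f (take n (drop i xs)) # drop (i + n) xs) =
          f (take j xs @ f (take n (drop j xs)) # drop (j + n) xs)"
    and solvable: "\<lbrakk>length us + length vs = n - 1; set us \<subseteq> G; set vs \<subseteq> G; y \<in> G\<rbrakk> \<Longrightarrow>
          \<exists>!z. z \<in> G \<and> f (us @ z # vs) = y"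

definition skew :: "nat \<Rightarrow> 'a set \<Rightarrow> ('a list \<Rightarrow> 'a) \<Rightarrow> 'a \<Rightarrow> 'a" where
  "skew n G f x = (THE z. z \<in> G \<and> f (replicate (n - 1) x @ [z]) = x)"

text \<open>Used only on lists of length \<open>n\<close> or \<open>2 * n - 1\<close>; in the latter case the position of the
  inner application is immaterial by associativity.\<close>

definition f_star :: "nat \<Rightarrow> ('a list \<Rightarrow> 'a) \<Rightarrow> 'a list \<Rightarrow> 'a" where
  "f_star n f xs = (if length xs = n then f xs else f (f (take n xs) # drop n xs))"

definition diamond :: "nat \<Rightarrow> nat \<Rightarrow> nat \<Rightarrow> nat" where
  "diamond n r s = (r + s + 1) mod (n - 1)"

definition covering_group ::
  "nat \<Rightarrow> 'a set \<Rightarrow> ('a list \<Rightarrow> 'a) \<Rightarrow> 'a \<Rightarrow> ('a \<times> nat) monoid" where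
  "covering_group n G f a =
    \<lparr>carrier = G \<times> {..n - 2},
     mult = (\<lambda>(x, r) (y, s).
       (f_star n f ([x] @ replicate r a @ [y] @ replicate s a @ [skew n G f a] @
                    replicate (n - 2 - diamond n r s) a),
        diamond n r s)),
     one = (skew n G f a, n - 2)\<rparr>"

definition embed_cover :: "'a \<Rightarrow> 'a \<times> nat" where
  "embed_cover x = (x, 0)"

text \<open>The vector space \<open>V\<close> is the whole type \<open>'v\<close> with scalar multiplication \<open>scale\<close>; this
  includes the zero space, for instance \<^typ>\<open>unit\<close>.\<close>

definition GL :: "(complex \<Rightarrow> 'v::ab_group_add \<Rightarrow> 'v) \<Rightarrow> ('v \<Rightarrow> 'v) monoid" where
  "GL scale =
    \<lparr>carrier = {T. Vector_Spaces.linear scale scale T \<and> bij T}, mult = (\<circ>), one = id\<rparr>"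

definition group_representation ::
  "('g, 'b) monoid_scheme \<Rightarrow> (complex \<Rightarrow> 'v::ab_group_add \<Rightarrow> 'v) \<Rightarrow> ('g \<Rightarrow> 'v \<Rightarrow> 'v) \<Rightarrow> bool" where
  "group_representation H scale \<Gamma> \<longleftrightarrow> \<Gamma> \<in> hom H (GL scale)"

definition nary_kernel :: "'a set \<Rightarrow> ('a \<Rightarrow> 'v \<Rightarrow> 'v) \<Rightarrow> 'a set" where
  "nary_kernel G \<Lambda> = {x \<in> G. \<Lambda> x = id}"

definition nary_representation ::
  "nat \<Rightarrow> 'a set \<Rightarrow> ('a list \<Rightarrow> 'a) \<Rightarrow> (complex \<Rightarrow> 'v::ab_group_add \<Rightarrow> 'v) \<Rightarrow> ('a \<Rightarrow> 'v \<Rightarrow> 'v) \<Rightarrow> bool"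
  where
  "nary_representation n G f scale \<Lambda> \<longleftrightarrow>
    \<Lambda> \<in> G \<rightarrow> carrier (GL scale) \<and>
    (\<forall>xs. length xs = n \<and> set xs \<subseteq> G \<longrightarrow> \<Lambda> (f xs) = foldr (\<circ>) (map \<Lambda> xs) id) \<and>
    nary_kernel G \<Lambda> \<noteq> {}"

text \<open>Irreducibility of \<open>V\<close> under the operators \<open>\<Lambda> x\<close>, \<open>x \<in> X\<close>; here \<open>X\<close> is the carrier
  of a group or of an \<open>n\<close>-ary group.\<close>

definition irreducible_on ::
  "'x set \<Rightarrow> (complex \<Rightarrow> 'v::ab_group_add \<Rightarrow> 'v) \<Rightarrow> ('x \<Rightarrow> 'v \<Rightarrow> 'v) \<Rightarrow> bool" where
  "irreducible_on X scale \<Lambda> \<longleftrightarrow>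
    (\<exists>v::'v. v \<noteq> 0) \<and>
    (\<forall>W. module.subspace scale W \<and> (\<forall>x\<in>X. \<Lambda> x ` W \<subseteq> W) \<longrightarrow> W = {0} \<or> W = UNIV)"

end

theory Submission imports Defs begin

text \<open>
  Everything rests on the shape of products of elements of \<open>G\<close> inside the covering group:
  for \<open>1 \<le> k < n\<close>,
  \<open>x\<^sub>1 \<cdot> \<dots> \<cdot> x\<^sub>k = \<langle>f (x\<^sub>1, \<dots>, x\<^sub>k, skew a, a, \<dots>, a), k - 1\<rangle>\<close>, and
  \<open>x\<^sub>1 \<cdot> \<dots> \<cdot> x\<^sub>n = \<langle>f (x\<^sub>1, \<dots>, x\<^sub>n), 0\<rangle>\<close>.
  Both follow by multiplying with one more factor on the left
  (\<open>covering_mult_embed\<close> and \<open>covering_mult_embed_last\<close>), because the word consisting of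
  \<open>skew a\<close> and \<open>n - 2\<close> letters \<open>a\<close>, with \<open>skew a\<close> at either end, can be cancelled
  (\<open>skew_left_unit\<close>, \<open>skew_right_unit\<close>).
  The products are built up from the right to match the right-nested composition of operators
  in the definition of a representation of \<open>G\<close>.

  The product of \<open>n\<close> factors shows that \<open>\<Gamma>\<close> restricted to \<open>G\<close> is always multiplicative with
  respect to \<open>f\<close>; what remains of the definition of a representation of \<open>G\<close> is the non-empty
  kernel, which is the stated criterion.  In the formula for \<open>k = r + 1\<close>
  factors with \<open>x\<^sub>2 = \<dots> = x\<^sub>k = a\<close> the
  equation \<open>f (x\<^sub>1, a, \<dots>, a, skew a, a, \<dots>, a) = x\<close> is solvable for \<open>x\<^sub>1\<close>, so every
  \<open>\<langle>x, r\<rangle>\<close> is a product of elements of \<open>G\<close>.  Hence a subspace invariant under \<open>G\<close> is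
  invariant under the whole covering group, and irreducibility passes to \<open>G\<close>.
\<close>

section \<open>Skew elements\<close>

context nary_group
begin

text \<open>Associativity with the position of the inner application given by a factorization of the
  long word instead of by indices.\<close>

lemma assoc_regroup:
  assumes "ps @ xs @ ss = qs @ ys @ ts"
    and "length xs = n" and "length ys = n" and "length (ps @ ss) = n - 1"
    and "set (ps @ xs @ ss) \<subseteq> G"
  shows "f (ps @ f xs # ss) = f (qs @ f ys # ts)"
proof -
  let ?w = "ps @ xs @ ss"
  have len: "length ?w = 2 * n - 1"
    using assms(2,4) arity by simp
  moreover have "length ?w = length qs + n + length ts"
    using assms(1,3) by simp
  ultimately have "length ps < n" "length qs < n"
    using assms(4) arity by simp_all
  with assoc[OF len assms(5), of "length ps" "length qs"]
  have "f (take (length ps) ?w @ f (take n (drop (length ps) ?w)) # drop (length ps + n) ?w) =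
        f (take (length qs) ?w @ f (take n (drop (length qs) ?w)) # drop (length qs + n) ?w)"
    by blast
  moreover have "take (length ps) ?w = ps" "take n (drop (length ps) ?w) = xs"
    "drop (length ps + n) ?w = ss"
    using assms(2) by simp_all
  moreover have "take (length qs) ?w = qs" "take n (drop (length qs) ?w) = ys"
    "drop (length qs + n) ?w = ts"
    using assms(3) unfolding assms(1) by simp_all
  ultimately show ?thesis by (simp only:)
qed

lemma cancel:
  assumes "f (us @ y # vs) = f (us @ z # vs)"
    and "length us + length vs = n - 1" and "set us \<subseteq> G" and "set vs \<subseteq> G"
    and "y \<in> G" and "z \<in> G"
  shows "y = z"
proof -
  have "f (us @ z # vs) \<in> G"
    using assms arity by (intro closed) auto
  from solvable[OF assms(2-4) this] show ?thesis
    using assms(1,5,6) by blast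
qed

lemma skew_closed_eq:
  assumes "x \<in> G"
  shows "skew n G f x \<in> G \<and> f (replicate (n - 1) x @ [skew n G f x]) = x"
proof -
  have "\<exists>!z. z \<in> G \<and> f (replicate (n - 1) x @ z # []) = x"
    using assms by (intro solvable) auto
  from theI'[OF this] show ?thesis
    unfolding skew_def .
qed

end

locale pointed_nary_group = nary_group +
  fixes a :: 'a
  assumes a_in: "a \<in> G"
begin

abbreviation sk :: 'a where "sk \<equiv> skew n G f a"

lemma sk_in: "sk \<in> G"
  using skew_closed_eq[OF a_in] by blast

lemma replicate_pred:
  "replicate (n - 1) a = a # replicate (n - 2) a"
  "replicate (n - 1) a = replicate (n - 2) a @ [a]"
proof -
  have "n - 1 = Suc (n - 2)"
    using arity by simp
  then show "replicate (n - 1) a = a # replicate (n - 2) a"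
    "replicate (n - 1) a = replicate (n - 2) a @ [a]"
    by (simp_all only: replicate_Suc replicate_append_same)
qed

lemma replicate_commute:
  "replicate k a @ replicate m a @ xs = replicate m a @ replicate k a @ xs"
  by (metis append_assoc replicate_add add.commute)

text \<open>The defining equation has the skew element in the last position; cancelling \<open>n - 1\<close>
  letters \<open>a\<close> on the left brings it to the first.\<close>

lemma skew_first: "f (sk # replicate (n - 1) a) = a"
proof -
  let ?A = "replicate (n - 1) a"
  have "f (?A @ f (sk # ?A) # []) = f ([] @ f (?A @ [sk]) # ?A)"
    using arity sk_in a_in by (intro assoc_regroup) auto
  also have "\<dots> = f (?A @ a # [])"
    using skew_closed_eq[OF a_in] by (simp add: replicate_app_Cons_same)
  finally have eq: "f (?A @ f (sk # ?A) # []) = f (?A @ a # [])" .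
  have "f (sk # ?A) \<in> G"
    using arity sk_in a_in by (intro closed) auto
  then show ?thesis
    by (rule cancel[OF eq, rotated 3]) (use a_in in auto)
qed

text \<open>Writing \<open>z\<close> as \<open>f (w, a, \<dots>, a)\<close> moves the letters \<open>a\<close> next to \<open>skew a\<close>, where the
  defining equation of the skew element applies.\<close>

lemma skew_right_unit:
  assumes "z \<in> G"
  shows "f (z # replicate (n - 2) a @ [sk]) = z"
proof -
  let ?A = "replicate (n - 1) a" and ?B = "replicate (n - 2) a"
  have "\<exists>!w. w \<in> G \<and> f ([] @ w # ?A) = z"
    using assms a_in by (intro solvable) auto
  then obtain w where w: "w \<in> G" "f (w # ?A) = z"
    by auto
  have "f ([] @ f (w # ?A) # (?B @ [sk])) = f ((w # ?B) @ f (?A @ [sk]) # [])"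
  proof (rule assoc_regroup)
    show "[] @ (w # ?A) @ ?B @ [sk] = (w # ?B) @ (?A @ [sk]) @ []"
      using replicate_commute by simp
  qed (use arity sk_in a_in w in auto)
  also have "\<dots> = z"
    using skew_closed_eq[OF a_in] w(2) replicate_pred(2) by (simp del: replicate_append_same)
  finally show ?thesis
    using w(2) by simp
qed

text \<open>Cancelling the right factor \<open>a, \<dots>, a\<close>, the claim becomes the equation of
  \<open>skew_first\<close> inside a longer word.\<close>

lemma skew_left_unit:
  assumes "z \<in> G"
  shows "f (z # sk # replicate (n - 2) a) = z"
proof -
  let ?A = "replicate (n - 1) a" and ?B = "replicate (n - 2) a"
  have "f ([] @ f (z # sk # ?B) # ?A) = f ([z] @ f (sk # ?A) # ?B)"
  proof (rule assoc_regroup)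
    show "[] @ (z # sk # ?B) @ ?A = [z] @ (sk # ?A) @ ?B"
      using replicate_commute[of _ _ "[]"] by simp
  qed (use arity sk_in a_in assms in auto)
  also have "\<dots> = f ([] @ z # ?A)"
    using skew_first replicate_pred(1) by simp
  finally have eq: "f ([] @ f (z # sk # ?B) # ?A) = f ([] @ z # ?A)" .
  have "f (z # sk # ?B) \<in> G"
    using arity sk_in a_in assms by (intro closed) auto
  then show ?thesis
    by (rule cancel[OF eq, rotated 3]) (use a_in assms in auto)
qed

section \<open>Products of embedded elements in the covering group\<close>

text \<open>The element of \<open>G\<close> which, paired with \<open>k - 1\<close>, is the product in the covering group
  of the \<open>k\<close> elements of the list, for \<open>1 \<le> k < n\<close> (\<open>hom_pad\<close> below records this under a
  homomorphism).\<close>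

definition pad :: "'a list \<Rightarrow> 'a" where
  "pad xs = f (xs @ sk # replicate (n - 1 - length xs) a)"

lemma pad_closed:
  assumes "length xs < n" and "set xs \<subseteq> G"
  shows "pad xs \<in> G"
  unfolding pad_def using assms sk_in a_in by (intro closed) auto

lemma pad_singleton:
  assumes "x \<in> G"
  shows "pad [x] = x"
proof -
  have "n - 1 - length [x] = n - 2"
    by simp
  then show ?thesis
    using skew_left_unit[OF assms] by (simp only: pad_def append.simps)
qed

text \<open>The multiplication spells out a word \<open>x, f (xs, skew a, a, \<dots>), a, \<dots>, skew a, a, \<dots>\<close> of
  length \<open>n\<close>.  Its \<open>a\<close>'s between the two occurrences of \<open>skew a\<close> number exactly \<open>n - 2\<close>, so
  regrouping collapses that block to a single \<open>skew a\<close> by \<open>skew_right_unit\<close>.\<close>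

lemma covering_mult_embed:
  assumes "x \<in> G" and "set xs \<subseteq> G" and "xs \<noteq> []" and "length xs < n - 1"
  shows "embed_cover x \<otimes>\<^bsub>covering_group n G f a\<^esub> (pad xs, length xs - 1) =
    (pad (x # xs), length xs)"
proof -
  define k where "k = length xs"
  have k: "0 < k" "k < n - 1" "length xs = k"
    using assms by (auto simp: k_def)
  let ?R = "\<lambda>m. replicate m a"
  have d: "diamond n 0 (k - 1) = k"
    using k by (simp add: diamond_def)
  have "?R (n - 1 - k) @ ?R (k - 1) = ?R (n - 2)"
    using k by (simp flip: replicate_add)
  then have "f ([x] @ f (xs @ sk # ?R (n - 1 - k)) # (?R (k - 1) @ sk # ?R (n - 2 - k))) =
    f ((x # xs) @ f (sk # ?R (n - 2) @ [sk]) # ?R (n - 2 - k))"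
    by (intro assoc_regroup) (use k assms sk_in a_in in auto)
  also have "\<dots> = pad (x # xs)"
  proof -
    have "n - 1 - length (x # xs) = n - 2 - k"
      using k by simp
    then show ?thesis
      using skew_right_unit[OF sk_in] by (simp only: pad_def append.simps append_assoc)
  qed
  finally have "f (x # pad xs # ?R (k - 1) @ sk # ?R (n - 2 - k)) = pad (x # xs)"
    using k by (simp add: pad_def)
  moreover have "length (x # pad xs # ?R (k - 1) @ sk # ?R (n - 2 - k)) = n"
    using k by simp
  ultimately show ?thesis
    using k d by (simp add: covering_group_def embed_cover_def f_star_def del: length_append)
qed

text \<open>For the \<open>n\<close>-th factor the second coordinate wraps around to \<open>0\<close> and the word has
  \<open>2 * n - 1\<close> letters; its tail \<open>skew a, a, \<dots>, a\<close>, and the one that \<open>pad xs\<close> leaves after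
  regrouping, cancel by \<open>skew_left_unit\<close>.\<close>

lemma covering_mult_embed_last:
  assumes "x \<in> G" and "set xs \<subseteq> G" and "length xs = n - 1"
  shows "embed_cover x \<otimes>\<^bsub>covering_group n G f a\<^esub> (pad xs, n - 2) = embed_cover (f (x # xs))"
proof -
  let ?B = "replicate (n - 2) a"
  have d: "diamond n 0 (n - 2) = 0"
  proof -
    have "0 + (n - 2) + 1 = n - 1"
      using arity by simp
    then show ?thesis
      by (simp only: diamond_def mod_self)
  qed
  have fx: "f (x # xs) \<in> G"
    using assms arity by (intro closed) auto
  have "f (x # pad xs # ?B) = f ([x] @ f (xs @ [sk]) # ?B)"
    using assms by (simp add: pad_def)
  also have "\<dots> = f ([] @ f (x # xs) # (sk # ?B))"
    by (rule assoc_regroup) (use arity sk_in a_in assms in auto)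
  also have "\<dots> = f (x # xs)"
    using skew_left_unit[OF fx] by simp
  finally have inner: "f (x # pad xs # ?B) = f (x # xs)" .
  let ?w = "(x # pad xs # ?B) @ sk # ?B"
  have "length ?w \<noteq> n" "take n ?w = x # pad xs # ?B" "drop n ?w = sk # ?B"
    using arity by (simp_all del: append.simps)
  then have "f_star n f ?w = f (x # xs)"
    using inner skew_left_unit[OF fx] by (simp only: f_star_def if_False)
  then show ?thesis
    using d by (simp add: covering_group_def embed_cover_def flip: numeral_2_eq_2)
qed

section \<open>Homomorphisms on the covering group\<close>

lemma hom_pad:
  fixes \<Gamma> :: "'a \<times> nat \<Rightarrow> 'v::ab_group_add \<Rightarrow> 'v"
  assumes hom: "\<Gamma> \<in> hom (covering_group n G f a) (GL scale)"
    and "set xs \<subseteq> G" and "xs \<noteq> []" and "length xs < n"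
  shows "\<Gamma> (pad xs, length xs - 1) = foldr (\<circ>) (map (\<Gamma> \<circ> embed_cover) xs) id"
  using assms(2-)
proof (induction xs)
  case (Cons x xs)
  show ?case
  proof (cases "xs = []")
    case True
    then show ?thesis
      using Cons.prems by (simp add: pad_singleton embed_cover_def)
  next
    case False
    have "embed_cover x \<in> carrier (covering_group n G f a)"
      "(pad xs, length xs - 1) \<in> carrier (covering_group n G f a)"
      using Cons.prems pad_closed[of xs] by (auto simp: covering_group_def embed_cover_def)
    from hom_mult[OF hom this]
    have "\<Gamma> (pad (x # xs), length xs) = \<Gamma> (embed_cover x) \<circ> \<Gamma> (pad xs, length xs - 1)"
      using Cons.prems False covering_mult_embed[of x xs] by (simp add: GL_def)
    then show ?thesis
      using Cons False by simp
  qed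
qed simp

lemma hom_nary_op:
  fixes \<Gamma> :: "'a \<times> nat \<Rightarrow> 'v::ab_group_add \<Rightarrow> 'v"
  assumes hom: "\<Gamma> \<in> hom (covering_group n G f a) (GL scale)"
    and "length ys = n" and "set ys \<subseteq> G"
  shows "\<Gamma> (embed_cover (f ys)) = foldr (\<circ>) (map (\<Gamma> \<circ> embed_cover) ys) id"
proof -
  obtain x xs where ys: "ys = x # xs"
    using assms(2) arity by (cases ys) auto
  have xs: "x \<in> G" "set xs \<subseteq> G" "length xs = n - 1" "length xs - 1 = n - 2" "xs \<noteq> []" "length xs < n"
    using assms ys arity by auto
  have "embed_cover x \<in> carrier (covering_group n G f a)"
    "(pad xs, n - 2) \<in> carrier (covering_group n G f a)"
    using xs pad_closed[of xs] by (auto simp: covering_group_def embed_cover_def)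
  from hom_mult[OF hom this]
  have "\<Gamma> (embed_cover (f ys)) = \<Gamma> (embed_cover x) \<circ> \<Gamma> (pad xs, n - 2)"
    using covering_mult_embed_last[OF xs(1-3)] ys by (simp add: GL_def)
  then show ?thesis
    using hom_pad[OF hom xs(2,5,6)] xs(4) ys by simp
qed

text \<open>The word \<open>y, a, \<dots>, a\<close> of length \<open>r + 1\<close> has a product with second coordinate \<open>r\<close>, whose
  first coordinate can be prescribed through \<open>y\<close>.\<close>

lemma covering_generated:
  assumes "x \<in> G" and "r \<le> n - 2"
  obtains ys where "set ys \<subseteq> G" "length ys = r + 1" "pad ys = x"
proof -
  have "\<exists>!y. y \<in> G \<and> f ([] @ y # (replicate r a @ sk # replicate (n - 2 - r) a)) = x"
    using assms arity a_in sk_in by (intro solvable) auto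
  then obtain y where "y \<in> G" "f ([] @ y # (replicate r a @ sk # replicate (n - 2 - r) a)) = x"
    by blast
  moreover have "n - 1 - length (y # replicate r a) = n - 2 - r"
    by simp
  ultimately have "pad (y # replicate r a) = x"
    by (simp only: pad_def append.simps)
  then show ?thesis
    using \<open>y \<in> G\<close> a_in by (intro that[of "y # replicate r a"]) auto
qed

lemma foldr_comp_invariant:
  assumes "\<And>x. x \<in> set xs \<Longrightarrow> h x ` W \<subseteq> W"
  shows "foldr (\<circ>) (map h xs) id ` W \<subseteq> W"
  using assms by (induction xs) (auto simp: image_subset_iff)

lemma invariant_covering:
  fixes \<Gamma> :: "'a \<times> nat \<Rightarrow> 'v::ab_group_add \<Rightarrow> 'v"
  assumes hom: "\<Gamma> \<in> hom (covering_group n G f a) (GL scale)"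
    and inv: "\<forall>x\<in>G. \<Gamma> (embed_cover x) ` W \<subseteq> W"
    and "g \<in> carrier (covering_group n G f a)"
  shows "\<Gamma> g ` W \<subseteq> W"
proof -
  obtain x r where g: "g = (x, r)" "x \<in> G" "r \<le> n - 2"
    using assms(3) by (auto simp: covering_group_def)
  obtain ys where ys: "set ys \<subseteq> G" "length ys = r + 1" "pad ys = x"
    using covering_generated[OF g(2,3)] .
  then have "ys \<noteq> []" "length ys < n"
    using g(3) arity by auto
  then have "\<Gamma> g = foldr (\<circ>) (map (\<Gamma> \<circ> embed_cover) ys) id"
    using hom_pad[OF hom ys(1)] ys(2,3) g(1) by simp
  then show ?thesis
    using foldr_comp_invariant[of ys "\<Gamma> \<circ> embed_cover" W] inv ys(1) by auto
qed

end

section \<open>Restricting representations\<close>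

theorem proposition4p2:
  fixes n :: nat and G :: "'a set" and f :: "'a list \<Rightarrow> 'a" and a :: 'a
    and scale :: "complex \<Rightarrow> 'v::ab_group_add \<Rightarrow> 'v" and Basis :: "'v set"
    and \<Gamma> :: "'a \<times> nat \<Rightarrow> 'v \<Rightarrow> 'v"
  assumes "nary_group n G f"
    and "a \<in> G"
    and "finite_dimensional_vector_space scale Basis"
    and "group_representation (covering_group n G f a) scale \<Gamma>"
  shows "(nary_representation n G f scale (\<Gamma> \<circ> embed_cover) \<longleftrightarrow>
            kernel (covering_group n G f a) (GL scale) \<Gamma> \<inter> embed_cover ` G \<noteq> {}) \<and>
         (irreducible_on (carrier (covering_group n G f a)) scale \<Gamma> \<longrightarrow>
            irreducible_on G scale (\<Gamma> \<circ> embed_cover))"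
proof -
  interpret pointed_nary_group n G f a
    using assms(1,2) by (intro pointed_nary_group.intro pointed_nary_group_axioms.intro)
  have hom: "\<Gamma> \<in> hom (covering_group n G f a) (GL scale)"
    using assms(4) by (simp add: group_representation_def)
  have embed: "embed_cover x \<in> carrier (covering_group n G f a)" if "x \<in> G" for x
    using that by (simp add: covering_group_def embed_cover_def)
  have "(\<Gamma> \<circ> embed_cover) \<in> G \<rightarrow> carrier (GL scale)"
    using hom_in_carrier[OF hom] embed by auto
  moreover have "kernel (covering_group n G f a) (GL scale) \<Gamma> \<inter> embed_cover ` G =
      embed_cover ` nary_kernel G (\<Gamma> \<circ> embed_cover)"
    using embed by (auto simp: kernel_def nary_kernel_def GL_def)
  ultimately have "nary_representation n G f scale (\<Gamma> \<circ> embed_cover) \<longleftrightarrow>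
      kernel (covering_group n G f a) (GL scale) \<Gamma> \<inter> embed_cover ` G \<noteq> {}"
    using hom_nary_op[OF hom] by (simp add: nary_representation_def)
  moreover have "irreducible_on G scale (\<Gamma> \<circ> embed_cover)"
    if "irreducible_on (carrier (covering_group n G f a)) scale \<Gamma>"
    using that invariant_covering[OF hom] unfolding irreducible_on_def by simp
  ultimately show ?thesis by blast
qed

end
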